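(* Let $q$ be a prime power and $n$ an integer such that $1<n\le q$ and $(n-1)\mid(q-1)$. Then every element of $\mathbb{F}_q$ is a sum of an $n$-potent and a tripotent of $\mathbb{F}_q$ if and only if either $n=q$, or $q\in\{3,5,7,9\}$ and $n=\frac{q+1}{2}$.
   Context: $\mathbb{F}_q$ is the finite field with $q$ elements. An element $t$ is $n$-potent if $t^n=t$, and tripotent if $t^3=t$. *)

theory Defs
  imports "HOL-Number_Theory.Prime_Powers"
begin

definition potent :: "nat \<Rightarrow> 'a::monoid_mult \<Rightarrow> bool" where
  "potent n t \<longleftrightarrow> t ^ n = t"

definition tripotent :: "'a::monoid_mult \<Rightarrow> bool" where
  "tripotent t \<longleftrightarrow> t ^ 3 = t"

end

theory Submission imports Defs "HOL-Computational_Algebra.Polynomial"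
begin

text \<open>
  A field has only the tripotents \<open>0\<close>, \<open>1\<close>, \<open>-1\<close>, and at most \<open>n\<close> elements that are \<open>n\<close>-potent,
  namely \<open>0\<close> and the \<open>(n - 1)\<close>-th roots of unity. Discounting the sums that coincide
  because \<open>0\<close> and \<open>1\<close> are \<open>n\<close>-potent as well, a field with \<open>q\<close> elements in which every
  element is a sum satisfies \<open>q \<le> 3 n - 2\<close> (\<open>card_cover_le\<close>). Hence \<open>k = (q - 1) / (n - 1)\<close> is at
  most \<open>3\<close>. If \<open>k = 3\<close>, then \<open>-1\<close> is \<open>n\<close>-potent too, so even more sums coincide and the bound
  becomes strict (\<open>card_cover_less\<close>), a contradiction. If \<open>k = 1\<close>, then \<open>n = q\<close> and every
  element is \<open>n\<close>-potent.

  The interesting case is \<open>k = 2\<close>. Now \<open>q\<close> is odd and the \<open>n\<close>-potents are the squares, so the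
  sums fill the field iff no three consecutive elements \<open>x - 1, x, x + 1\<close> are all nonsquares
  (\<open>cover_half_iff\<close>). With the quadratic character \<open>\<chi>\<close>, each such triple contributes \<open>8\<close> to
  \<open>\<Sum>x. (1 - \<chi>(x - 1)) (1 - \<chi> x) (1 - \<chi>(x + 1)) = q - 3 - S\<close>, where \<open>S = \<Sum>x. \<chi>(x\<^sup>3 - x)\<close>;
  among the other summands at most that at \<open>x = -1\<close> is nonzero. The sum \<open>S\<close> counts points on
  an elliptic curve, and the Hasse bound \<open>S\<^sup>2 \<le> 4 q\<close> is elementary for this curve: it suffices
  to average over the twists \<open>\<Sum>x. \<chi>(x\<^sup>3 - a x)\<close>, whose squares take the same value for all nonzero
  squares \<open>a\<close> (\<open>jacobsthal_1_squared_le\<close>). If \<open>-1\<close> is a square, the summand at \<open>x = -1\<close> vanishes, so the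
  absence of triples forces \<open>(q - 3)\<^sup>2 \<le> 4 q\<close>, that is \<open>q \<le> 9\<close>; if \<open>-1\<close> is a nonsquare, then \<open>S = 0\<close>
  by symmetry and \<open>q - 3 \<le> 4\<close>.

  The four odd values \<open>q \<le> 9\<close> that remain do occur. For \<open>q = 3\<close> all elements are tripotent, and
  \<open>q = 5\<close> and \<open>q = 7\<close> are settled by listing the elements. For \<open>q = 9\<close>, the product
  \<open>y = (x - 1) x (x + 1) = x\<^sup>3 - x\<close> satisfies \<open>y\<^sup>3 = -y\<close> and is therefore a square.
\<close>

section \<open>Finite fields\<close>

lemma finite_field_power_card_minus_1:
  fixes x :: "'a::{field,finite}"
  assumes "x \<noteq> 0"
  shows "x ^ (card (UNIV :: 'a set) - 1) = 1"
proof -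
  let ?P = "\<Prod>y\<in>UNIV-{0::'a}. y"
  have "?P = (\<Prod>y\<in>UNIV-{0}. x * y)"
    by (rule prod.reindex_bij_witness[of _ "\<lambda>y. x * y" "\<lambda>y. y / x"]) (use assms in auto)
  also have "\<dots> = x ^ (card (UNIV :: 'a set) - 1) * ?P"
    by (simp add: prod.distrib)
  finally show ?thesis by simp
qed

lemma finite_field_power_card:
  fixes x :: "'a::{field,finite}"
  shows "x ^ card (UNIV :: 'a set) = x"
proof (cases "x = 0")
  case False
  have "x ^ card (UNIV :: 'a set) = x * x ^ (card (UNIV :: 'a set) - 1)"
    by (simp add: power_eq_if)
  also have "\<dots> = x" by (simp only: finite_field_power_card_minus_1[OF False] mult_1_right)
  finally show ?thesis .
qed (simp add: power_0_left)

text \<open>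
  Translation by \<open>1\<close> permutes the field, so it does not change the sum of all elements.
\<close>
lemma of_nat_card_finite_field: "of_nat (card (UNIV :: 'a set)) = (0 :: 'a::{field,finite})"
proof -
  have "(\<Sum>x\<in>(UNIV :: 'a set). x) = (\<Sum>x\<in>UNIV. x + 1)"
    by (rule sum.reindex_bij_witness[of _ "\<lambda>x. x + 1" "\<lambda>x. x - 1"]) auto
  then show ?thesis by (simp add: sum.distrib)
qed

lemma two_neq_zero_odd_card:
  assumes "odd (card (UNIV :: 'a::{field,finite} set))"
  shows "(2 :: 'a) \<noteq> 0"
proof
  assume two: "(2 :: 'a) = 0"
  obtain k where "card (UNIV :: 'a set) = 2 * k + 1" using assms by (auto elim: oddE)
  then show False
    using of_nat_card_finite_field[where 'a = 'a] two by simp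
qed

lemma card_roots_of_unity_le:
  assumes "0 < m"
  shows "card {x :: 'a::{field,finite}. x ^ m = 1} \<le> m"
proof -
  let ?p = "monom 1 m - 1 :: 'a poly"
  have "coeff ?p m = 1" using assms by simp
  then have nz: "?p \<noteq> 0" by (metis coeff_0 zero_neq_one)
  have "{x :: 'a. x ^ m = 1} = {x. poly ?p x = 0}" by (simp add: poly_monom)
  moreover have "degree ?p \<le> m" by (intro degree_diff_le) (auto simp: degree_monom_le)
  ultimately show ?thesis using card_poly_roots_bound[OF nz] by simp
qed

section \<open>Potents, tripotents and a counting bound\<close>

lemma potent_iff:
  fixes x :: "'a::field"
  assumes "1 < n"
  shows "potent n x \<longleftrightarrow> x = 0 \<or> x ^ (n - 1) = 1"
  using assms by (cases n) (auto simp: potent_def power_0_left)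

lemma tripotent_iff:
  fixes x :: "'a::field"
  shows "tripotent x \<longleftrightarrow> x \<in> {0, 1, -1}"
  by (auto simp: tripotent_def power3_eq_cube) (metis square_eq_1_iff)

lemma card_potents_le:
  assumes "1 < n"
  shows "card {x :: 'a::{field,finite}. potent n x} \<le> n"
proof -
  have "{x :: 'a. potent n x} = insert 0 {x. x ^ (n - 1) = 1}"
    using assms by (auto simp: potent_iff)
  then have "card {x :: 'a. potent n x} \<le> Suc (card {x :: 'a. x ^ (n - 1) = 1})"
    by (simp add: card_insert_le_m1 card_insert_if)
  with card_roots_of_unity_le[of "n - 1", where 'a = 'a] assms show ?thesis by linarith
qed

lemma card_translates_le:
  fixes A D B :: "'a::{ab_group_add,finite} set"
  shows "card (\<Union>a\<in>A. (+) a ` B) \<le> card A * card B"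
proof -
  have "card (\<Union>a\<in>A. (+) a ` B) \<le> (\<Sum>a\<in>A. card ((+) a ` B))"
    by (rule card_UN_le) simp
  also have "\<dots> = card A * card B" by (simp add: card_image)
  finally show ?thesis .
qed

text \<open>
  The \<open>n\<close>-potents \<open>0\<close> and \<open>1\<close> together account for at most four sums, since \<open>0\<close> and \<open>1\<close> arise
  from both. Each of the other \<open>n - 2\<close> potents adds at most three.
\<close>
lemma card_cover_le:
  assumes n: "1 < n" and cov: "\<forall>x::'a::{field,finite}. \<exists>a b. potent n a \<and> tripotent b \<and> x = a + b"
  shows "card (UNIV :: 'a set) \<le> 3 * n - 2"
proof -
  let ?P = "{x :: 'a. potent n x}" and ?T = "{0, 1, -1 :: 'a}"
  have sub: "{0, 1} \<subseteq> ?P" using n by (auto simp: potent_iff)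
  have "UNIV \<subseteq> (\<Union>a\<in>?P - {0, 1}. (+) a ` ?T) \<union> {0, 1, -1, 2}"
  proof
    fix x :: 'a
    obtain a b where "potent n a" "tripotent b" "x = a + b" using cov by blast
    then show "x \<in> (\<Union>a\<in>?P - {0, 1}. (+) a ` ?T) \<union> {0, 1, -1, 2}"
      by (cases "a \<in> {0, 1}") (auto simp: tripotent_iff)
  qed
  then have "card (UNIV :: 'a set) \<le> card ((\<Union>a\<in>?P - {0, 1}. (+) a ` ?T) \<union> {0, 1, -1, 2})"
    by (intro card_mono) auto
  also have "\<dots> \<le> card (\<Union>a\<in>?P - {0, 1}. (+) a ` ?T) + card {0, 1, -1, 2 :: 'a}"
    by (rule card_Un_le)
  also have "\<dots> \<le> card (?P - {0, 1}) * card ?T + 4"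
    by (intro add_mono card_translates_le) (simp add: card_insert_if)
  also have "card (?P - {0, 1}) = card ?P - 2" using sub by (subst card_Diff_subset) auto
  also have "(card ?P - 2) * card ?T + 4 \<le> (n - 2) * 3 + 4"
    using card_potents_le[OF n, where 'a = 'a]
    by (intro add_mono mult_mono diff_le_mono) (auto simp: card_insert_if)
  also have "\<dots> = 3 * n - 2" using n by simp
  finally show ?thesis .
qed

text \<open>
  Here all tripotents are \<open>n\<close>-potent, and the sums of two tripotents are only the five elements
  \<open>0, 1, -1, 2, -2\<close>, or the two elements \<open>0, 1\<close> in characteristic \<open>2\<close>. This beats the
  bound of the previous lemma.
\<close>
lemma card_cover_less:
  assumes n: "1 < n" and cov: "\<forall>x::'a::{field,finite}. \<exists>a b. potent n a \<and> tripotent b \<and> x = a + b"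
    and neg: "potent n (- 1 :: 'a)"
  shows "card (UNIV :: 'a set) < 3 * n - 2"
proof -
  let ?P = "{x :: 'a. potent n x}" and ?T = "{0, 1, -1 :: 'a}" and ?TT = "{0, 1, -1, 2, -2 :: 'a}"
  have sub: "?T \<subseteq> ?P" using n neg by (auto simp: potent_iff)
  have "UNIV \<subseteq> (\<Union>a\<in>?P - ?T. (+) a ` ?T) \<union> ?TT"
  proof
    fix x :: 'a
    obtain a b where "potent n a" "tripotent b" "x = a + b" using cov by blast
    then show "x \<in> (\<Union>a\<in>?P - ?T. (+) a ` ?T) \<union> ?TT"
      by (cases "a \<in> ?T") (auto simp: tripotent_iff)
  qed
  then have "card (UNIV :: 'a set) \<le> card ((\<Union>a\<in>?P - ?T. (+) a ` ?T) \<union> ?TT)"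
    by (intro card_mono) auto
  also have "\<dots> \<le> card (\<Union>a\<in>?P - ?T. (+) a ` ?T) + card ?TT"
    by (rule card_Un_le)
  also have "\<dots> \<le> card (?P - ?T) * card ?T + card ?TT"
    by (intro add_mono card_translates_le) simp
  also have "card (?P - ?T) = card ?P - card ?T" using sub by (subst card_Diff_subset) auto
  finally have le: "card (UNIV :: 'a set) \<le> (card ?P - card ?T) * card ?T + card ?TT" .
  have P: "card ?T \<le> card ?P" "card ?P \<le> n"
    using card_mono[OF _ sub] card_potents_le[OF n, where 'a = 'a] by simp_all
  show ?thesis
  proof (cases "(-1 :: 'a) = 1")
    case True
    then have two: "(2 :: 'a) = 0" by (metis add.right_inverse one_add_one)
    have "card ?T = 2" "card ?TT = 2" using True two by (simp_all add: card_insert_if)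
    with le P n show ?thesis by simp
  next
    case False
    then have "card ?T = 3" using not_sym[OF False] by (simp add: card_insert_if)
    moreover have "card ?TT \<le> 5" by (simp add: card_insert_if)
    ultimately show ?thesis using le P n by simp
  qed
qed

section \<open>The quadratic character\<close>

text \<open>
  Squares are recognised by Euler's criterion, which makes multiplicativity immediate. The value
  is the usual quadratic character when the field has odd order, the only case in which it is used.
\<close>
definition quad_char :: "'a::{field,finite} \<Rightarrow> int" where
  "quad_char x = (if x = 0 then 0
     else if x ^ ((card (UNIV :: 'a set) - 1) div 2) = 1 then 1 else - 1)"

lemma quad_char_0 [simp]: "quad_char 0 = 0" and quad_char_1 [simp]: "quad_char 1 = 1"
  by (simp_all add: quad_char_def)

lemma quad_char_eq_0_iff [simp]: "quad_char x = 0 \<longleftrightarrow> x = 0"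
  by (simp add: quad_char_def)

lemma quad_char_cases: "quad_char x \<in> {0, 1, -1}"
  by (simp add: quad_char_def)

lemma quad_char_square_nonzero: "x \<noteq> 0 \<Longrightarrow> quad_char x * quad_char x = 1"
  by (simp add: quad_char_def)

lemma half_power_cases:
  assumes "odd (card (UNIV :: 'a::{field,finite} set))" "(x :: 'a) \<noteq> 0"
  shows "x ^ ((card (UNIV :: 'a set) - 1) div 2) \<in> {1, -1}"
proof -
  have "(x ^ ((card (UNIV :: 'a set) - 1) div 2))\<^sup>2 = 1"
    using assms finite_field_power_card_minus_1[of x] by (simp flip: power_mult)
  then show ?thesis by (simp add: power2_eq_1_iff)
qed

lemma neg_one_neq_one_odd_card:
  assumes "odd (card (UNIV :: 'a::{field,finite} set))"
  shows "(- 1 :: 'a) \<noteq> 1"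
  using two_neq_zero_odd_card[OF assms] by (metis add.right_inverse one_add_one)

lemma quad_char_mult:
  assumes odd: "odd (card (UNIV :: 'a::{field,finite} set))"
  shows "quad_char (x * y :: 'a) = quad_char x * quad_char y"
proof (cases "x = 0 \<or> y = 0")
  case False
  then show ?thesis
    using half_power_cases[OF odd, of x] half_power_cases[OF odd, of y] neg_one_neq_one_odd_card[OF odd]
    by (auto simp: quad_char_def power_mult_distrib)
qed auto

lemma quad_char_power2:
  assumes "odd (card (UNIV :: 'a::{field,finite} set))" "(x :: 'a) \<noteq> 0"
  shows "quad_char (x\<^sup>2) = 1"
  using assms by (simp add: power2_eq_square quad_char_mult quad_char_square_nonzero)

text \<open>
  Multiplication by an element \<open>g\<close> of character \<open>-1\<close> permutes the field and negates the sum.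
  Such \<open>g\<close> exists because \<open>X ^ ((q - 1) div 2) - 1\<close> has too few roots.
\<close>
lemma sum_quad_char:
  assumes odd: "odd (card (UNIV :: 'a::{field,finite} set))"
  shows "(\<Sum>x\<in>(UNIV :: 'a set). quad_char x) = 0"
proof -
  let ?q = "card (UNIV :: 'a set)" and ?m = "(card (UNIV :: 'a set) - 1) div 2"
  have "card {0, 1 :: 'a} \<le> ?q" by (rule card_mono) auto
  then have q: "2 \<le> ?q" by simp
  with odd have m: "0 < ?m" "?q = 2 * ?m + 1" by presburger+
  have "card (insert 0 {x :: 'a. x ^ ?m = 1}) \<le> Suc ?m"
    using card_roots_of_unity_le[OF m(1), where 'a = 'a] by (simp add: card_insert_if)
  also have "\<dots> < ?q" using m by linarith
  finally have "insert 0 {x :: 'a. x ^ ?m = 1} \<noteq> UNIV" by auto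
  then obtain g :: 'a where "g \<noteq> 0" "g ^ ?m \<noteq> 1" by auto
  then have g: "g \<noteq> 0" "quad_char g = -1" by (simp_all add: quad_char_def)
  have "(\<Sum>x\<in>(UNIV :: 'a set). quad_char x) = (\<Sum>x\<in>(UNIV :: 'a set). quad_char (g * x))"
    by (rule sum.reindex_bij_witness[of _ "\<lambda>y. g * y" "\<lambda>y. y / g"]) (use g in auto)
  also have "\<dots> = - (\<Sum>x\<in>(UNIV :: 'a set). quad_char x)"
    by (simp add: quad_char_mult[OF odd] g sum_negf)
  finally show ?thesis by simp
qed

text \<open>
  After a translation the summand is \<open>\<chi>(t) \<chi>(t + d) = \<chi>(1 + d / t)\<close> for \<open>t \<noteq> 0\<close>. If \<open>d \<noteq> 0\<close>,
  the argument \<open>1 + d / t\<close> runs through all elements other than \<open>1\<close>.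
\<close>
lemma sum_quad_char_shifted_product:
  assumes odd: "odd (card (UNIV :: 'a::{field,finite} set))"
  shows "(\<Sum>t\<in>UNIV. quad_char (t + a) * quad_char (t + b :: 'a)) =
    (if a = b then int (card (UNIV :: 'a set)) - 1 else - 1)"
proof -
  let ?d = "b - a"
  have "(\<Sum>t\<in>UNIV. quad_char (t + a) * quad_char (t + b)) =
      (\<Sum>t\<in>UNIV. quad_char t * quad_char (t + ?d))"
    by (rule sum.reindex_bij_witness[of _ "\<lambda>t. t - a" "\<lambda>t. t + a"]) (auto simp: algebra_simps)
  also have "\<dots> = (\<Sum>t\<in>UNIV - {0}. quad_char t * quad_char (t + ?d))"
    by (rule sum.mono_neutral_right) auto
  also have "\<dots> = (\<Sum>t\<in>UNIV - {0}. quad_char (1 + ?d / t))"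
  proof (rule sum.cong)
    fix t :: 'a assume t: "t \<in> UNIV - {0}"
    then have "t + ?d = t * (1 + ?d / t)" by (simp add: field_simps)
    then have "quad_char (t + ?d) = quad_char t * quad_char (1 + ?d / t)"
      by (metis quad_char_mult[OF odd])
    with t show "quad_char t * quad_char (t + ?d) = quad_char (1 + ?d / t)"
      using quad_char_square_nonzero[of t] by (simp flip: mult.assoc)
  qed simp
  also have "\<dots> = (if a = b then int (card (UNIV :: 'a set)) - 1 else - 1)"
  proof (cases "a = b")
    case True
    have "0 < card (UNIV :: 'a set)" by (simp add: finite_UNIV_card_ge_0)
    with True show ?thesis by (simp add: of_nat_diff)
  next
    case False
    have "(\<Sum>t\<in>UNIV - {0}. quad_char (1 + ?d / t)) = (\<Sum>w\<in>UNIV - {1 :: 'a}. quad_char w)"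
      by (rule sum.reindex_bij_witness[of _ "\<lambda>w. ?d / (w - 1)" "\<lambda>t. 1 + ?d / t"])
        (use False in auto)
    also have "\<dots> = -1"
      using sum_quad_char[OF odd] by (simp add: sum_diff1)
    finally show ?thesis using False by simp
  qed
  finally show ?thesis .
qed

section \<open>Jacobsthal sums\<close>

text \<open>
  This is \<open>\<Sum>x. \<chi>(x\<^sup>3 - a x)\<close>. For \<open>a \<noteq> 0\<close> it is, up to sign, the trace of Frobenius of the
  elliptic curve \<open>y\<^sup>2 = x\<^sup>3 - a x\<close>.
\<close>
definition jacobsthal :: "'a::{field,finite} \<Rightarrow> int" where
  "jacobsthal a = (\<Sum>x\<in>UNIV. quad_char x * quad_char (x\<^sup>2 - a))"

lemma jacobsthal_eq_0:
  assumes odd: "odd (card (UNIV :: 'a::{field,finite} set))" and "quad_char (- 1 :: 'a) = - 1"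
  shows "jacobsthal (a :: 'a) = 0"
proof -
  have minus: "quad_char (- x) = - quad_char x" for x :: 'a
    using quad_char_mult[OF odd, of "- 1" x] assms(2) by simp
  have "jacobsthal a = (\<Sum>x\<in>UNIV. quad_char (- x) * quad_char ((- x)\<^sup>2 - a))"
    unfolding jacobsthal_def
    by (rule sum.reindex_bij_witness[of _ uminus uminus]) auto
  also have "\<dots> = - jacobsthal a"
    by (simp add: jacobsthal_def minus sum_negf)
  finally show ?thesis by simp
qed

text \<open>
  Substituting \<open>c x\<close> for \<open>x\<close> pulls out the factor \<open>\<chi>(c)\<^sup>3\<close>, which is a sign.
\<close>
lemma jacobsthal_square:
  assumes odd: "odd (card (UNIV :: 'a::{field,finite} set))" and c: "(c :: 'a) \<noteq> 0"
  shows "(jacobsthal (c\<^sup>2))\<^sup>2 = (jacobsthal (1 :: 'a))\<^sup>2"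
proof -
  have "jacobsthal (c\<^sup>2) = (\<Sum>x\<in>UNIV. quad_char (c * x) * quad_char ((c * x)\<^sup>2 - c\<^sup>2))"
    unfolding jacobsthal_def
    by (rule sum.reindex_bij_witness[of _ "\<lambda>y. c * y" "\<lambda>y. y / c"]) (use c in auto)
  also have "\<dots> = (\<Sum>x\<in>(UNIV :: 'a set). quad_char c * (quad_char x * quad_char (x\<^sup>2 - 1)))"
  proof (rule sum.cong)
    fix x :: 'a
    have "(c * x)\<^sup>2 - c\<^sup>2 = c\<^sup>2 * (x\<^sup>2 - 1)" by (simp add: algebra_simps power_mult_distrib)
    then show "quad_char (c * x) * quad_char ((c * x)\<^sup>2 - c\<^sup>2) =
        quad_char c * (quad_char x * quad_char (x\<^sup>2 - 1))"
      by (simp add: quad_char_mult[OF odd] quad_char_power2[OF odd c])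
  qed simp
  also have "\<dots> = quad_char c * jacobsthal (1 :: 'a)" by (simp add: jacobsthal_def sum_distrib_left)
  finally show ?thesis
    using quad_char_square_nonzero[OF c] by (simp add: power_mult_distrib power2_eq_square)
qed

lemma card_square_roots_le: "card {c :: 'a::{field,finite}. c\<^sup>2 = a} \<le> 2"
proof (cases "\<exists>c. c\<^sup>2 = a")
  case True
  then obtain c where "c\<^sup>2 = a" ..
  then have "{c. c\<^sup>2 = a} \<subseteq> {c, - c}" by (auto simp: power2_eq_iff)
  then have "card {c. c\<^sup>2 = a} \<le> card {c, - c}" by (intro card_mono) auto
  also have "\<dots> \<le> 2" by (simp add: card_insert_if)
  finally show ?thesis .
qed simp

text \<open>
  Expanding the square and summing over \<open>a\<close> first leaves
  \<open>\<chi>(x) \<chi>(y) \<Sum>a. \<chi>(x\<^sup>2 - a) \<chi>(y\<^sup>2 - a)\<close>, where the inner sum is \<open>q - 1\<close> for \<open>y = x\<close> or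
  \<open>y = -x\<close> and \<open>-1\<close> otherwise. The constant part \<open>-1\<close> cancels because \<open>\<chi>\<close> sums to \<open>0\<close>.
\<close>
lemma sum_jacobsthal_squared_le:
  assumes odd: "odd (card (UNIV :: 'a::{field,finite} set))"
  defines "q \<equiv> int (card (UNIV :: 'a set))"
  shows "(\<Sum>a\<in>(UNIV :: 'a set). (jacobsthal a)\<^sup>2) \<le> 2 * q * (q - 1)"
proof -
  let ?X = "quad_char :: 'a \<Rightarrow> int"
  have inner: "(\<Sum>a\<in>UNIV. ?X (x\<^sup>2 - a) * ?X (y\<^sup>2 - a)) = (if x\<^sup>2 = y\<^sup>2 then q else 0) - 1" for x y
  proof -
    have "(\<Sum>a\<in>UNIV. ?X (x\<^sup>2 - a) * ?X (y\<^sup>2 - a)) = (\<Sum>t\<in>UNIV. ?X (t + x\<^sup>2) * ?X (t + y\<^sup>2))"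
      by (rule sum.reindex_bij_witness[of _ uminus uminus]) auto
    then show ?thesis by (simp add: sum_quad_char_shifted_product[OF odd] q_def)
  qed
  have "(\<Sum>a\<in>UNIV. (jacobsthal (a :: 'a))\<^sup>2) =
      (\<Sum>a\<in>UNIV. \<Sum>x\<in>UNIV. \<Sum>y\<in>UNIV. ?X x * ?X y * (?X (x\<^sup>2 - a) * ?X (y\<^sup>2 - a)))"
    by (simp add: jacobsthal_def power2_eq_square sum_product mult_ac)
  also have "\<dots> = (\<Sum>x\<in>UNIV. \<Sum>a\<in>UNIV. \<Sum>y\<in>UNIV. ?X x * ?X y * (?X (x\<^sup>2 - a) * ?X (y\<^sup>2 - a)))"
    by (rule sum.swap)
  also have "\<dots> = (\<Sum>x\<in>UNIV. \<Sum>y\<in>UNIV. \<Sum>a\<in>UNIV. ?X x * ?X y * (?X (x\<^sup>2 - a) * ?X (y\<^sup>2 - a)))"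
    by (intro sum.cong sum.swap refl)
  also have "\<dots> = (\<Sum>x\<in>UNIV. \<Sum>y\<in>UNIV. ?X x * ?X y * ((if x\<^sup>2 = y\<^sup>2 then q else 0) - 1))"
    by (simp only: inner flip: sum_distrib_left)
  also have "\<dots> = (\<Sum>x\<in>UNIV. \<Sum>y\<in>UNIV. q * (if y\<^sup>2 = x\<^sup>2 then ?X x * ?X y else 0) - ?X x * ?X y)"
    by (intro sum.cong) (auto simp: algebra_simps)
  also have "\<dots> = q * (\<Sum>x\<in>UNIV. \<Sum>y\<in>UNIV. if y\<^sup>2 = x\<^sup>2 then ?X x * ?X y else 0)
      - (\<Sum>x\<in>UNIV. \<Sum>y\<in>UNIV. ?X x * ?X y)"
    by (simp add: sum_subtractf sum_distrib_left)
  also have "(\<Sum>x\<in>UNIV. \<Sum>y\<in>UNIV. ?X x * ?X y) = 0"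
    by (simp add: sum_quad_char[OF odd] flip: sum_distrib_left)
  finally have eq: "(\<Sum>a\<in>UNIV. (jacobsthal (a :: 'a))\<^sup>2) =
      q * (\<Sum>x\<in>UNIV. \<Sum>y\<in>UNIV. if y\<^sup>2 = x\<^sup>2 then ?X x * ?X y else 0)" by simp
  have "(\<Sum>x\<in>UNIV. \<Sum>y\<in>UNIV. if y\<^sup>2 = x\<^sup>2 then ?X x * ?X y else 0) \<le>
      (\<Sum>x\<in>UNIV. if x = (0 :: 'a) then 0 else 2)"
  proof (rule sum_mono)
    fix x :: 'a
    have "(\<Sum>y\<in>UNIV. if y\<^sup>2 = x\<^sup>2 then ?X x * ?X y else 0) = (\<Sum>y | y\<^sup>2 = x\<^sup>2. ?X x * ?X y)"
      by (simp add: sum.If_cases)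
    also have "\<dots> \<le> (if x = 0 then 0 else 2)"
    proof (cases "x = 0")
      case False
      have "(\<Sum>y | y\<^sup>2 = x\<^sup>2. ?X x * ?X y) \<le> (\<Sum>y | y\<^sup>2 = x\<^sup>2. 1)"
      proof (rule sum_mono)
        fix y
        show "?X x * ?X y \<le> 1" using quad_char_cases[of x] quad_char_cases[of y] by auto
      qed
      with card_square_roots_le[of "x\<^sup>2"] False show ?thesis by simp
    qed simp
    finally show "(\<Sum>y\<in>UNIV. if y\<^sup>2 = x\<^sup>2 then ?X x * ?X y else 0) \<le> (if x = 0 then 0 else 2)" .
  qed
  also have "(\<Sum>x\<in>UNIV. if x = (0 :: 'a) then 0 else 2 :: int) = 2 * (q - 1)"
  proof -
    have "0 < card (UNIV :: 'a set)" by (simp add: finite_UNIV_card_ge_0)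
    moreover have "(\<Sum>x\<in>UNIV. if x = (0 :: 'a) then 0 else 2 :: int) = (\<Sum>x\<in>UNIV - {0 :: 'a}. 2)"
      by (rule sum.mono_neutral_cong_right) auto
    ultimately show ?thesis by (simp add: q_def of_nat_diff)
  qed
  finally have "q * (\<Sum>x\<in>UNIV. \<Sum>y\<in>UNIV. if y\<^sup>2 = x\<^sup>2 then ?X x * ?X y else 0) \<le> q * (2 * (q - 1))"
    by (rule mult_left_mono) (simp add: q_def)
  then show ?thesis unfolding eq by (simp add: mult_ac)
qed

text \<open>
  The summands at nonzero squares \<open>a = c\<^sup>2\<close> are all equal. Letting \<open>c\<close> run through the
  \<open>q - 1\<close> nonzero elements hits each of them at most twice.
\<close>
lemma jacobsthal_1_squared_le:
  assumes odd: "odd (card (UNIV :: 'a::{field,finite} set))"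
  shows "(jacobsthal (1 :: 'a))\<^sup>2 \<le> 4 * int (card (UNIV :: 'a set))"
proof -
  define q where "q = int (card (UNIV :: 'a set))"
  let ?J = "\<lambda>a :: 'a. (jacobsthal a)\<^sup>2"
  have "card {0, 1 :: 'a} \<le> card (UNIV :: 'a set)" by (rule card_mono) auto
  then have q: "2 \<le> q" by (simp add: q_def)
  have "(q - 1) * ?J 1 = (\<Sum>c\<in>UNIV - {0 :: 'a}. ?J (c\<^sup>2))"
    using q by (simp add: jacobsthal_square[OF odd] q_def of_nat_diff)
  also have "\<dots> \<le> (\<Sum>c\<in>(UNIV :: 'a set). ?J (c\<^sup>2))" by (rule sum_mono2) auto
  also have "\<dots> = (\<Sum>a\<in>UNIV. \<Sum>c | c \<in> UNIV \<and> c\<^sup>2 = a. ?J (c\<^sup>2))"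
    by (rule sum.group[symmetric]) auto
  also have "\<dots> = (\<Sum>a\<in>UNIV. int (card {c :: 'a. c\<^sup>2 = a}) * ?J a)"
    by (intro sum.cong refl) simp
  also have "\<dots> \<le> (\<Sum>a\<in>(UNIV :: 'a set). 2 * ?J a)"
    by (intro sum_mono mult_right_mono) (use card_square_roots_le in \<open>auto simp: numeral_le_iff\<close>)
  also have "\<dots> \<le> 2 * (2 * q * (q - 1))"
    using sum_jacobsthal_squared_le[OF odd] by (simp add: q_def flip: sum_distrib_left)
  finally have "(q - 1) * ?J 1 \<le> (q - 1) * (4 * q)" by (simp add: mult_ac)
  with q show ?thesis by (simp add: q_def)
qed

section \<open>Three consecutive nonsquares\<close>

text \<open>
  Multiplying out, the linear terms sum to \<open>0\<close>, each of the three products of two characters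
  sums to \<open>-1\<close>, and the product of all three is the summand \<open>\<chi>(x) \<chi>(x\<^sup>2 - 1)\<close>.
\<close>
lemma sum_nonsquare_triples:
  assumes odd: "odd (card (UNIV :: 'a::{field,finite} set))"
  shows "(\<Sum>x\<in>(UNIV :: 'a set). (1 - quad_char (x - 1)) * (1 - quad_char x) * (1 - quad_char (x + 1)))
    = int (card (UNIV :: 'a set)) - 3 - jacobsthal (1 :: 'a)"
proof -
  let ?X = "quad_char :: 'a \<Rightarrow> int"
  have s: "(\<Sum>x\<in>UNIV. ?X (x + c)) = 0" for c
    using sum_quad_char[OF odd]
    by (subst sum.reindex_bij_witness[of UNIV "\<lambda>x. x - c" "\<lambda>x. x + c" UNIV ?X]) auto
  have p: "(\<Sum>x\<in>UNIV. ?X (x + a) * ?X (x + b)) = - 1" if "a \<noteq> b" for a b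
    using that by (simp add: sum_quad_char_shifted_product[OF odd])
  have "(- 1 :: 'a) \<noteq> 1" by (rule neg_one_neq_one_odd_card[OF odd])
  then have pairs: "(\<Sum>x\<in>UNIV. ?X (x + - 1) * ?X (x + 0)) = - 1"
      "(\<Sum>x\<in>UNIV. ?X (x + - 1) * ?X (x + 1)) = - 1"
      "(\<Sum>x\<in>UNIV. ?X (x + 0) * ?X (x + 1)) = - 1"
    by (intro p; simp)+
  have "(\<Sum>x\<in>UNIV. (1 - ?X (x - 1)) * (1 - ?X x) * (1 - ?X (x + 1))) =
    (\<Sum>x\<in>UNIV. 1 - ?X (x + - 1) - ?X (x + 0) - ?X (x + 1) + ?X (x + - 1) * ?X (x + 0)
      + ?X (x + - 1) * ?X (x + 1) + ?X (x + 0) * ?X (x + 1) - ?X x * ?X (x\<^sup>2 - 1))"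
  proof (rule sum.cong)
    fix x :: 'a
    have "x\<^sup>2 - 1 = (x - 1) * (x + 1)" by (simp add: power2_eq_square algebra_simps)
    then have "?X (x\<^sup>2 - 1) = ?X (x - 1) * ?X (x + 1)" by (simp only: quad_char_mult[OF odd])
    then show "(1 - ?X (x - 1)) * (1 - ?X x) * (1 - ?X (x + 1)) =
      1 - ?X (x + - 1) - ?X (x + 0) - ?X (x + 1) + ?X (x + - 1) * ?X (x + 0)
      + ?X (x + - 1) * ?X (x + 1) + ?X (x + 0) * ?X (x + 1) - ?X x * ?X (x\<^sup>2 - 1)"
      by (simp add: algebra_simps)
  qed simp
  also have "\<dots> = int (card (UNIV :: 'a set)) - 0 - 0 - 0 + - 1 + - 1 + - 1 - jacobsthal (1 :: 'a)"
    unfolding sum.distrib sum_subtractf s pairs jacobsthal_def by simp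
  finally show ?thesis by simp
qed

text \<open>
  A nonzero summand of the preceding sum has no factor with \<open>\<chi> = 1\<close>, so without three consecutive
  nonsquares one of \<open>x - 1, x, x + 1\<close> is \<open>0\<close>. Since \<open>\<chi>(1) = 1\<close>, only \<open>x = -1\<close>
  remains.
\<close>
lemma card_le_9_if_no_nonsquare_triple:
  assumes odd: "odd (card (UNIV :: 'a::{field,finite} set))"
    and none: "\<And>x :: 'a. quad_char (x - 1) \<noteq> - 1 \<or> quad_char x \<noteq> - 1 \<or> quad_char (x + 1) \<noteq> - 1"
  shows "card (UNIV :: 'a set) \<le> 9"
proof -
  let ?X = "quad_char :: 'a \<Rightarrow> int"
  define q where "q = int (card (UNIV :: 'a set))"
  define f where "f x = (1 - ?X (x - 1)) * (1 - ?X x) * (1 - ?X (x + 1))" for x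
  have "f x = 0" if "x \<noteq> - 1" for x
  proof (rule ccontr)
    assume "f x \<noteq> 0"
    then have ne: "?X (x - 1) \<noteq> 1" "?X x \<noteq> 1" "?X (x + 1) \<noteq> 1" by (auto simp: f_def)
    then have "x \<noteq> 0" "x \<noteq> 1" by auto
    with ne that none[of x] quad_char_cases[of "x - 1"] quad_char_cases[of x] quad_char_cases[of "x + 1"]
    show False by (auto simp: add_eq_0_iff2)
  qed
  then have "(\<Sum>x\<in>UNIV. f x) = f (- 1)"
    by (subst sum.mono_neutral_right[of UNIV "{- 1}"]) auto
  then have S: "f (- 1) = q - 3 - jacobsthal (1 :: 'a)"
    using sum_nonsquare_triples[OF odd] by (simp add: f_def q_def)
  have "?X (- 1) = 1 \<or> ?X (- 1) = - 1" using quad_char_cases[of "- 1 :: 'a"] by simp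
  then have "q \<le> 9"
  proof
    assume "?X (- 1) = 1"
    then have J: "jacobsthal (1 :: 'a) = q - 3" using S by (simp add: f_def)
    have "(q - 3)\<^sup>2 \<le> 4 * q" using jacobsthal_1_squared_le[OF odd] by (simp add: J q_def)
    \<comment> \<open>\<open>(q - 3)\<^sup>2 - 4 q = q\<^sup>2 - 10 q + 9\<close>\<close>
    then have "(q - 1) * (q - 9) \<le> 0" by (simp add: power2_eq_square algebra_simps)
    then show ?thesis by (smt (verit) mult_pos_pos)
  next
    assume neg: "?X (- 1) = - 1"
    have "f (- 1) \<le> 4" using quad_char_cases[of "- 2 :: 'a"] neg by (auto simp: f_def)
    with S jacobsthal_eq_0[OF odd neg] show ?thesis by simp
  qed
  then show ?thesis by (simp add: q_def)
qed

section \<open>The exceptional fields\<close>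

lemma cover_card_5:
  assumes "card (UNIV :: 'a::{field,finite} set) = 5"
  shows "\<exists>a b. potent 3 a \<and> tripotent b \<and> (x :: 'a) = a + b"
proof -
  have five: "(5 :: 'a) = 0" using of_nat_card_finite_field[where 'a = 'a] assms by simp
  have "x ^ 5 = x" using finite_field_power_card[of x] assms by simp
  moreover have "x * (x - 1) * (x + 1) * (x - 2) * (x + 2) = x ^ 5 - x - 5 * (x ^ 3 - x)"
    by (simp add: power_numeral_reduce algebra_simps)
  ultimately have "x * (x - 1) * (x + 1) * (x - 2) * (x + 2) = 0" by (simp add: five)
  then have "x = 0 + 0 \<or> x = 0 + 1 \<or> x = 0 + - 1 \<or> x = 1 + 1 \<or> x = - 1 + - 1"
    by (auto simp: eq_neg_iff_add_eq_0)
  moreover have "potent 3 (0 :: 'a)" "potent 3 (1 :: 'a)" "potent 3 (- 1 :: 'a)"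
    by (simp_all add: potent_iff)
  moreover have "tripotent (0 :: 'a)" "tripotent (1 :: 'a)" "tripotent (- 1 :: 'a)"
    by (simp_all add: tripotent_iff)
  ultimately show ?thesis by blast
qed

text \<open>
  The \<open>4\<close>-potents are \<open>0, 1, 2, 4\<close>; the elements not reached at once are \<open>-2 = 4 + 1\<close> and
  \<open>-3 = 4\<close>.
\<close>
lemma cover_card_7:
  assumes "card (UNIV :: 'a::{field,finite} set) = 7"
  shows "\<exists>a b. potent 4 a \<and> tripotent b \<and> (x :: 'a) = a + b"
proof -
  have seven: "(7 :: 'a) = 0" using of_nat_card_finite_field[where 'a = 'a] assms by simp
  have "x ^ 7 = x" using finite_field_power_card[of x] assms by simp
  moreover have "x * (x - 1) * (x + 1) * (x - 2) * (x + 2) * (x - 3) * (x + 3) =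
      x ^ 7 - x - 7 * (2 * x ^ 5 - 7 * x ^ 3 + 5 * x)"
    by (simp add: power_numeral_reduce algebra_simps)
  ultimately have "x * (x - 1) * (x + 1) * (x - 2) * (x + 2) * (x - 3) * (x + 3) = 0"
    by (simp add: seven)
  then have "x = 0 + 0 \<or> x = 0 + 1 \<or> x = 0 + - 1 \<or> x = 2 + 0 \<or> x + 2 = 0 \<or> x = 2 + 1 \<or> x + 3 = 0"
    by (auto simp: eq_neg_iff_add_eq_0)
  moreover have "x = 4 + 1" if "x + 2 = 0"
  proof -
    have "x - (4 + 1) = (x + 2) - 7" by simp
    then show ?thesis using that seven by simp
  qed
  moreover have "x = 4 + 0" if "x + 3 = 0"
  proof -
    have "x - (4 + 0) = (x + 3) - 7" by simp
    then show ?thesis using that seven by simp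
  qed
  moreover have "potent 4 (2 :: 'a)" "potent 4 (4 :: 'a)"
  proof -
    have "(2 :: 'a) ^ 4 = 2 + 7 * 2" "(4 :: 'a) ^ 4 = 4 + 7 * 36" by simp_all
    then show "potent 4 (2 :: 'a)" "potent 4 (4 :: 'a)" unfolding potent_def seven by simp_all
  qed
  moreover have "potent 4 (0 :: 'a)" by (simp add: potent_iff)
  moreover have "tripotent (0 :: 'a)" "tripotent (1 :: 'a)" "tripotent (- 1 :: 'a)"
    by (simp_all add: tripotent_iff)
  ultimately show ?thesis by blast
qed

text \<open>
  In characteristic \<open>3\<close> the product \<open>y = x\<^sup>3 - x\<close> of the triple has \<open>y\<^sup>3 = x\<^sup>9 - x\<^sup>3 = -y\<close>, so
  \<open>y = 0\<close> or \<open>y ^ 4 = 1\<close>. A product of three nonsquares would have character \<open>-1\<close>.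
\<close>
lemma no_nonsquare_triple_card_9:
  fixes x :: "'a::{field,finite}"
  assumes card: "card (UNIV :: 'a set) = 9"
  shows "quad_char (x - 1) \<noteq> - 1 \<or> quad_char x \<noteq> - 1 \<or> quad_char (x + 1) \<noteq> - 1"
proof (rule ccontr)
  assume neg: "\<not> ?thesis"
  have odd: "odd (card (UNIV :: 'a set))" by (simp add: card)
  have "(3 :: 'a) * 3 = of_nat (card (UNIV :: 'a set))" by (simp add: card)
  then have three: "(3 :: 'a) = 0" by (simp only: of_nat_card_finite_field mult_eq_0_iff disj_absorb)
  define y where "y = (x - 1) * x * (x + 1)"
  have y: "quad_char y = - 1" using neg by (simp add: y_def quad_char_mult[OF odd])
  have x9: "x ^ 9 = x" using finite_field_power_card[of x] card by simp
  have yx: "y = x ^ 3 - x" by (simp add: y_def power3_eq_cube algebra_simps)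
  have "y ^ 3 = x ^ 9 - x ^ 3 - 3 * (x ^ 7 - x ^ 5)"
    unfolding yx by (simp add: power_numeral_reduce algebra_simps)
  also have "\<dots> = - y" unfolding x9 yx three by simp
  finally have y3: "y ^ 3 = - y" .
  have "y * (y\<^sup>2 + 1) = y ^ 3 + y" by (simp add: power3_eq_cube power2_eq_square algebra_simps)
  also have "\<dots> = 0" unfolding y3 by simp
  finally have "y = 0 \<or> y\<^sup>2 = - 1" by (simp add: add_eq_0_iff2)
  moreover have "y ^ 4 = 1" if "y\<^sup>2 = - 1"
  proof -
    have "y ^ 4 = (y\<^sup>2)\<^sup>2" by (simp flip: power_mult)
    then show ?thesis unfolding that by simp
  qed
  ultimately have "y = 0 \<or> y ^ 4 = 1" by blast
  then have "quad_char y \<noteq> - 1" by (auto simp: quad_char_def card)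
  with y show False by simp
qed

text \<open>
  With \<open>n - 1 = (q - 1) / 2\<close>, Euler's criterion says that the \<open>n\<close>-potents are \<open>0\<close> and the
  nonzero squares.
\<close>
lemma cover_half_iff:
  assumes card: "card (UNIV :: 'a::{field,finite} set) = 2 * n - 1" and n: "1 < n"
  shows "(\<forall>x :: 'a. \<exists>a b. potent n a \<and> tripotent b \<and> x = a + b) \<longleftrightarrow>
    (\<forall>x :: 'a. quad_char (x - 1) \<noteq> - 1 \<or> quad_char x \<noteq> - 1 \<or> quad_char (x + 1) \<noteq> - 1)"
proof -
  have odd: "odd (card (UNIV :: 'a set))" using card n by simp
  have m: "(card (UNIV :: 'a set) - 1) div 2 = n - 1" using card n by simp
  have pot: "potent n a \<longleftrightarrow> quad_char a \<noteq> - 1" for a :: 'a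
    unfolding potent_iff[OF n] quad_char_def m by auto
  have "(\<exists>a b. potent n a \<and> tripotent b \<and> x = a + b) \<longleftrightarrow>
      quad_char (x - 1) \<noteq> - 1 \<or> quad_char x \<noteq> - 1 \<or> quad_char (x + 1) \<noteq> - 1" for x :: 'a
  proof -
    have "(\<exists>a b. potent n a \<and> tripotent b \<and> x = a + b) \<longleftrightarrow> (\<exists>b\<in>{0, 1, - 1}. quad_char (x - b) \<noteq> - 1)"
      unfolding pot tripotent_iff by (metis add_diff_cancel_right' diff_add_cancel)
    then show ?thesis by auto
  qed
  then show ?thesis by simp
qed

section \<open>Classification\<close>

theorem lemma2p1:
  fixes q n :: nat
  assumes "primepow q"
    and "card (UNIV :: 'a::{field,finite} set) = q"
    and "1 < n" and "n \<le> q" and "(n - 1) dvd (q - 1)"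
  shows "(\<forall>x::'a. \<exists>a b. potent n a \<and> tripotent b \<and> x = a + b) \<longleftrightarrow>
    (n = q \<or> (q \<in> {3, 5, 7, 9} \<and> n = (q + 1) div 2))"
proof
  note card = assms(2) and n = assms(3)
  assume cov: "\<forall>x::'a. \<exists>a b. potent n a \<and> tripotent b \<and> x = a + b"
  obtain k where k: "q - 1 = (n - 1) * k" using assms(5) by (auto elim: dvdE)
  have "(n - 1) * k \<le> (n - 1) * 3" using card_cover_le[OF n cov] card k n by linarith
  then have "k \<le> 3" using n by simp
  moreover have "k \<noteq> 0" using k n assms(4) by (intro notI) simp
  moreover have "k \<noteq> 3"
  proof
    assume "k = 3"
    then have q: "q = 3 * n - 2" using k n assms(4) by simp
    have "potent n (- 1 :: 'a)"
    \<comment> \<open>\<open>q - 1 = 3 (n - 1)\<close> has the parity of \<open>n - 1\<close>, so if \<open>n - 1\<close> is odd, the characteristic is \<open>2\<close>.\<close>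
    proof (cases "even (n - 1)")
      case True
      then show ?thesis using n by (simp add: potent_iff)
    next
      case False
      then have "odd (q - 1)" using q n by simp
      then have "(- 1 :: 'a) = 1"
        using finite_field_power_card_minus_1[of "- 1 :: 'a"] card by simp
      moreover have "potent n (1 :: 'a)" by (simp add: potent_def)
      ultimately show ?thesis by (simp only:)
    qed
    from card_cover_less[OF n cov this] card q show False by simp
  qed
  ultimately consider "k = 1" | "k = 2" by linarith
  then show "n = q \<or> (q \<in> {3, 5, 7, 9} \<and> n = (q + 1) div 2)"
  proof cases
    case 1
    then have "n = q" using k n assms(4) by simp
    then show ?thesis ..
  next
    case 2
    then have q: "q = 2 * n - 1" using k n assms(4) by simp
    have "q \<le> 9"
      using card_le_9_if_no_nonsquare_triple[where 'a = 'a] cov cover_half_iff[of n, where 'a = 'a]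
        card q n by simp
    with q n have "n \<in> {2, 3, 4, 5}" by auto
    with q show ?thesis by auto
  qed
next
  note card = assms(2) and n = assms(3)
  assume "n = q \<or> (q \<in> {3, 5, 7, 9} \<and> n = (q + 1) div 2)"
  then consider "n = q" | "q = 3" | "q = 5" "n = 3" | "q = 7" "n = 4" | "q = 9" "n = 5" by auto
  then show "\<forall>x::'a. \<exists>a b. potent n a \<and> tripotent b \<and> x = a + b"
  proof cases
    case 1
    then have "potent n x \<and> tripotent (0 :: 'a) \<and> x = x + 0" for x :: 'a
      using finite_field_power_card[of x] card by (simp add: potent_def tripotent_iff)
    then show ?thesis by blast
  next
    case 2
    then have "potent n (0 :: 'a) \<and> tripotent x \<and> x = 0 + x" for x :: 'a
      using finite_field_power_card[of x] card n by (simp add: potent_iff tripotent_def)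
    then show ?thesis by blast
  next
    case 3
    then show ?thesis using cover_card_5[where 'a = 'a] card by simp
  next
    case 4
    then show ?thesis using cover_card_7[where 'a = 'a] card by simp
  next
    case 5
    then show ?thesis
      using cover_half_iff[of n, where 'a = 'a] no_nonsquare_triple_card_9[where 'a = 'a] card by simp
  qed
qed

end
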